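(* Consider a finite multistage game as described in the context and a player $i$. For every $h\in H_i^{\ast}$ and every ordered pair of distinct actions $(\overline{a}_i,a_i)\in A_i^h\times A_i^h$, let a partition of $S_{-i}(h)$ associated with $(\overline{a}_i,a_i)$ at $h$ be given (arbitrarily). Then, for each strategy $\overline{s}_i\in S_i$: the action $\overline{s}_i(h)$ is dominant at $h$ for every $h\in H_i^{\ast}(\overline{s}_i)$ if and only if the action $\overline{s}_i(h)$ is s-dominant at $h$ for every $h\in H_i^{\ast}(\overline{s}_i)$, where dominance and s-dominance are both assessed using the same given partitions.
   Context: Framework. A finite multistage game has a finite player set $I$. First, nature chooses $\theta$ from a nonempty finite set $\Theta$; then there are exactly $T\ge 1$ stages, and at each stage all players simultaneously choose an action. $A_i$ is the finite action set of player $i$ and $A=\times_{i\in I}A_i$. The set of stage-$1$ histories is $X^1=\Theta$; for $t=2,\dots,T$ the set of stage-$t$ histories is $X^t\subseteq\Theta\times A^{t-1}$; the set of terminal histories is $Z\subseteq\Theta\times A^{T}$. Let $X=\cup_{t=1}^T X^t$; $X\cup Z$ is ordered by the "prefix of" relation $\prec$. Each player $i$ has a partition $H_i$ of $X$ into information sets, each containing only histories of the same stage. At each $h\in H_i$ a nonempty set $A_i^h\subseteq A_i$ of actions is available; the feasible action profiles at a history $x\in X$ are exactly those whose $i$-th component lies in $A_i^h$ for the $h\in H_i$ containing $x$, for all $i$, and each feasible profile extends $x$ to a history of the next stage (or to a terminal history after stage $T$). Perfect recall holds: any two histories in the same information set of $i$ have the same sequence of previous information sets and previous actions of $i$. Player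 $i$ is active at $h$ if $|A_i^h|>1$; $H_i^{\ast}$ is the set of $h\in H_i$ where $i$ is active. Player $i$ has payoff function $u_i:Z\to\mathbb{R}$. Strategies. A (reduced) strategy $s_i$ of player $i$ assigns an action in $A_i^h$ to each $h\in H_i$ that can be reached given the actions assigned by $s_i$ to the previous information sets of $i$. $S_i$ is the set of strategies of $i$, and $S_{-i}=\Theta\times(\times_{j\ne i}S_j)$ (nature's move is included). $\zeta(s_i,s_{-i})\in Z$ is the terminal history induced by $(s_i,s_{-i})$. For $h\in H_i$, $S_i(h)$ and $S_{-i}(h)$ are the sets of elements of $S_i$ and $S_{-i}$ that allow $h$ to be reached. For $a_i\in A_i^h$, $S_i(h,a_i)=\{s_i\in S_i(h): s_i(h)=a_i\}$. $H_i^{\ast}(s_i)$ is the set of active information sets of $i$ that can be reached when $i$ plays $s_i$. Dominance. Let $h\in H_i^{\ast}$, $\overline{a}_i,a_i\in A_i^h$, and let $\mathcal{S}$ be a partition of $S_{-i}(h)$ (into nonempty cells). Action $\overline{a}_i$ dominates $a_i$ given $\mathcal{S}$ if for every $s_i\in S_i(h,a_i)$ there exists $\overline{s}_i\in S_i(h,\overline{a}_i)$ such that for all $\overline{S}_{-i}\in\mathcal{S}$, $\min_{s_{-i}\in\overline{S}_{-i}}u_i(\zeta(\overline{s}_i,s_{-i}))\ge\max_{s_{-i}\in\overline{S}_{-i}}u_i(\zeta(s_i,s_{-i}))$. Action $\overline{a}_i$ s-dominates (scenario-by-scenario dominates) $a_i$ given $\mathcal{S}$ if for every $\overline{S}_{-i}\in\mathcal{S}$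 and every $s_i\in S_i(h,a_i)$ there exists $\overline{s}_i\in S_i(h,\overline{a}_i)$ such that $\min_{s_{-i}\in\overline{S}_{-i}}u_i(\zeta(\overline{s}_i,s_{-i}))\ge\max_{s_{-i}\in\overline{S}_{-i}}u_i(\zeta(s_i,s_{-i}))$. Action $\overline{a}_i$ is dominant (s-dominant) at $h$ if it dominates (s-dominates) every other $a_i\in A_i^h$ given the partition associated with $(\overline{a}_i,a_i)$ at $h$. *)

theory Defs
  imports Complex_Main "HOL-Library.FuncSet" "HOL-Library.Disjoint_Sets" "HOL-Library.Sublist"
begin

text \<open>A history consists of nature's move and the list of action profiles played so far, in
  chronological order. A stage-\<open>t\<close> history thus carries \<open>t - 1\<close> profiles.\<close>

type_synonym ('i, 's, 'a) history = "'s \<times> ('i \<Rightarrow> 'a) list"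

type_synonym ('i, 's, 'a) infoset = "('i, 's, 'a) history set"

text \<open>Reduced strategies are partial maps; their domain is prescribed in \<open>strategies\<close> below.\<close>

type_synonym ('i, 's, 'a) strategy = "('i, 's, 'a) infoset \<rightharpoonup> 'a"

text \<open>A move of nature together with strategies of the players other than the one considered.\<close>

type_synonym ('i, 's, 'a) opp_strategy = "'s \<times> ('i \<Rightarrow> ('i, 's, 'a) strategy)"

text \<open>\<open>histories G t\<close> is $X^t$ and is meaningful for \<open>t \<in> {1..horizon G}\<close> only. \<open>available\<close> takes the
  player as an argument because the same set of histories may be an information set of several
  players.\<close>

record ('i, 's, 'a) game =
  players :: "'i set"
  states :: "'s set"
  horizon :: nat
  actions :: "'i \<Rightarrow> 'a set"
  histories :: "nat \<Rightarrow> ('i, 's, 'a) history set"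
  terminals :: "('i, 's, 'a) history set"
  infosets :: "'i \<Rightarrow> ('i, 's, 'a) infoset set"
  available :: "'i \<Rightarrow> ('i, 's, 'a) infoset \<Rightarrow> 'a set"
  payoff :: "'i \<Rightarrow> ('i, 's, 'a) history \<Rightarrow> real"

definition precedes :: "('i, 's, 'a) history \<Rightarrow> ('i, 's, 'a) history \<Rightarrow> bool" where
  "precedes x y \<longleftrightarrow> fst x = fst y \<and> strict_prefix (snd x) (snd y)"

definition nonterminals :: "('i, 's, 'a) game \<Rightarrow> ('i, 's, 'a) history set" where
  "nonterminals G = (\<Union>t\<in>{1..horizon G}. histories G t)"

definition infoset_of :: "('i, 's, 'a) game \<Rightarrow> 'i \<Rightarrow> ('i, 's, 'a) history \<Rightarrow> ('i, 's, 'a) infoset" where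
  "infoset_of G i x = (THE h. h \<in> infosets G i \<and> x \<in> h)"

definition feasible_profiles :: "('i, 's, 'a) game \<Rightarrow> ('i, 's, 'a) history \<Rightarrow> ('i \<Rightarrow> 'a) set" where
  "feasible_profiles G x = (\<Pi>\<^sub>E j\<in>players G. available G j (infoset_of G j x))"

definition successors :: "('i, 's, 'a) game \<Rightarrow> ('i, 's, 'a) history set \<Rightarrow> ('i, 's, 'a) history set" where
  "successors G Y = {(fst x, snd x @ [a]) |x a. x \<in> Y \<and> a \<in> feasible_profiles G x}"

text \<open>The sequence of previous information sets and own actions of player \<open>i\<close> along a history.\<close>

definition experience :: "('i, 's, 'a) game \<Rightarrow> 'i \<Rightarrow> ('i, 's, 'a) history \<Rightarrow> (('i, 's, 'a) infoset \<times> 'a) list" where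
  "experience G i x =
     map (\<lambda>k. (infoset_of G i (fst x, take k (snd x)), (snd x ! k) i)) [0..<length (snd x)]"

text \<open>The inclusions of the sets of histories in products of states and action profiles follow from
  the assumptions below, and so does the inclusion of feasible profiles in the profile set.\<close>

locale multistage_game =
  fixes G :: "('i, 's, 'a) game"
  assumes finite_players: "finite (players G)"
    and finite_states: "finite (states G)"
    and states_nonempty: "states G \<noteq> {}"
    and horizon_pos: "1 \<le> horizon G"
    and finite_actions: "\<And>i. i \<in> players G \<Longrightarrow> finite (actions G i)"
    and histories_1: "histories G 1 = {(\<theta>, []) |\<theta>. \<theta> \<in> states G}"
    and histories_Suc: "\<And>t. 1 \<le> t \<Longrightarrow> t < horizon G \<Longrightarrow>
      histories G (Suc t) = successors G (histories G t)"
    and terminals_eq: "terminals G = successors G (histories G (horizon G))"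
    and infosets_partition: "\<And>i. i \<in> players G \<Longrightarrow> partition_on (nonterminals G) (infosets G i)"
    and infosets_same_stage: "\<And>i h. i \<in> players G \<Longrightarrow> h \<in> infosets G i \<Longrightarrow>
      \<exists>t\<in>{1..horizon G}. h \<subseteq> histories G t"
    and available_nonempty: "\<And>i h. i \<in> players G \<Longrightarrow> h \<in> infosets G i \<Longrightarrow> available G i h \<noteq> {}"
    and available_subset: "\<And>i h. i \<in> players G \<Longrightarrow> h \<in> infosets G i \<Longrightarrow>
      available G i h \<subseteq> actions G i"
    and perfect_recall: "\<And>i h x y. i \<in> players G \<Longrightarrow> h \<in> infosets G i \<Longrightarrow> x \<in> h \<Longrightarrow> y \<in> h \<Longrightarrow>
      experience G i x = experience G i y"

definition active_infosets :: "('i, 's, 'a) game \<Rightarrow> 'i \<Rightarrow> ('i, 's, 'a) infoset set" where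
  "active_infosets G i = {h \<in> infosets G i. card (available G i h) > 1}"

text \<open>Under perfect recall it is immaterial which \<open>x \<in> h\<close> is taken here.\<close>

definition consistent :: "('i, 's, 'a) game \<Rightarrow> 'i \<Rightarrow> ('i, 's, 'a) strategy \<Rightarrow> ('i, 's, 'a) infoset \<Rightarrow> bool" where
  "consistent G i s h \<longleftrightarrow> (\<exists>x\<in>h. \<forall>(h', a)\<in>set (experience G i x). s h' = Some a)"

definition strategies :: "('i, 's, 'a) game \<Rightarrow> 'i \<Rightarrow> ('i, 's, 'a) strategy set" where
  "strategies G i = {s. dom s = {h \<in> infosets G i. consistent G i s h} \<and>
     (\<forall>h\<in>dom s. the (s h) \<in> available G i h)}"

definition opp_strategies :: "('i, 's, 'a) game \<Rightarrow> 'i \<Rightarrow> ('i, 's, 'a) opp_strategy set" where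
  "opp_strategies G i = states G \<times> (\<Pi>\<^sub>E j\<in>players G - {i}. strategies G j)"

primrec play :: "('i, 's, 'a) game \<Rightarrow> ('i \<Rightarrow> ('i, 's, 'a) strategy) \<Rightarrow> 's \<Rightarrow> nat \<Rightarrow> ('i, 's, 'a) history" where
  "play G \<sigma> \<theta> 0 = (\<theta>, [])"
| "play G \<sigma> \<theta> (Suc t) =
     (\<theta>, snd (play G \<sigma> \<theta> t) @ [\<lambda>j\<in>players G. the (\<sigma> j (infoset_of G j (play G \<sigma> \<theta> t)))])"

definition outcome :: "('i, 's, 'a) game \<Rightarrow> 'i \<Rightarrow> ('i, 's, 'a) strategy \<Rightarrow> ('i, 's, 'a) opp_strategy \<Rightarrow> ('i, 's, 'a) history" where
  "outcome G i s r = play G ((snd r)(i := s)) (fst r) (horizon G)"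

definition reaches :: "('i, 's, 'a) game \<Rightarrow> 'i \<Rightarrow> ('i, 's, 'a) strategy \<Rightarrow> ('i, 's, 'a) opp_strategy \<Rightarrow> ('i, 's, 'a) infoset \<Rightarrow> bool" where
  "reaches G i s r h \<longleftrightarrow> (\<exists>x\<in>h. precedes x (outcome G i s r))"

definition strategies_to :: "('i, 's, 'a) game \<Rightarrow> 'i \<Rightarrow> ('i, 's, 'a) infoset \<Rightarrow> ('i, 's, 'a) strategy set" where
  "strategies_to G i h = {s \<in> strategies G i. \<exists>r\<in>opp_strategies G i. reaches G i s r h}"

definition opp_strategies_to :: "('i, 's, 'a) game \<Rightarrow> 'i \<Rightarrow> ('i, 's, 'a) infoset \<Rightarrow> ('i, 's, 'a) opp_strategy set" where
  "opp_strategies_to G i h = {r \<in> opp_strategies G i. \<exists>s\<in>strategies G i. reaches G i s r h}"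

definition strategies_playing :: "('i, 's, 'a) game \<Rightarrow> 'i \<Rightarrow> ('i, 's, 'a) infoset \<Rightarrow> 'a \<Rightarrow> ('i, 's, 'a) strategy set" where
  "strategies_playing G i h a = {s \<in> strategies_to G i h. s h = Some a}"

definition active_infosets_under :: "('i, 's, 'a) game \<Rightarrow> 'i \<Rightarrow> ('i, 's, 'a) strategy \<Rightarrow> ('i, 's, 'a) infoset set" where
  "active_infosets_under G i s = {h \<in> active_infosets G i. s \<in> strategies_to G i h}"

definition dominates :: "('i, 's, 'a) game \<Rightarrow> 'i \<Rightarrow> ('i, 's, 'a) infoset \<Rightarrow> 'a \<Rightarrow> 'a \<Rightarrow> ('i, 's, 'a) opp_strategy set set \<Rightarrow> bool" where
  "dominates G i h b a P \<longleftrightarrow>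
     (\<forall>s\<in>strategies_playing G i h a. \<exists>s'\<in>strategies_playing G i h b. \<forall>C\<in>P.
        Min ((\<lambda>r. payoff G i (outcome G i s' r)) ` C) \<ge> Max ((\<lambda>r. payoff G i (outcome G i s r)) ` C))"

definition s_dominates :: "('i, 's, 'a) game \<Rightarrow> 'i \<Rightarrow> ('i, 's, 'a) infoset \<Rightarrow> 'a \<Rightarrow> 'a \<Rightarrow> ('i, 's, 'a) opp_strategy set set \<Rightarrow> bool" where
  "s_dominates G i h b a P \<longleftrightarrow>
     (\<forall>C\<in>P. \<forall>s\<in>strategies_playing G i h a. \<exists>s'\<in>strategies_playing G i h b.
        Min ((\<lambda>r. payoff G i (outcome G i s' r)) ` C) \<ge> Max ((\<lambda>r. payoff G i (outcome G i s r)) ` C))"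

text \<open>\<open>\<P> h b a\<close> is the partition associated with the ordered pair \<open>(b, a)\<close> at \<open>h\<close>.\<close>

definition dominant :: "('i, 's, 'a) game \<Rightarrow> 'i \<Rightarrow> (('i, 's, 'a) infoset \<Rightarrow> 'a \<Rightarrow> 'a \<Rightarrow> ('i, 's, 'a) opp_strategy set set) \<Rightarrow> ('i, 's, 'a) infoset \<Rightarrow> 'a \<Rightarrow> bool" where
  "dominant G i \<P> h b \<longleftrightarrow> (\<forall>a\<in>available G i h. a \<noteq> b \<longrightarrow> dominates G i h b a (\<P> h b a))"

definition s_dominant :: "('i, 's, 'a) game \<Rightarrow> 'i \<Rightarrow> (('i, 's, 'a) infoset \<Rightarrow> 'a \<Rightarrow> 'a \<Rightarrow> ('i, 's, 'a) opp_strategy set set) \<Rightarrow> ('i, 's, 'a) infoset \<Rightarrow> 'a \<Rightarrow> bool" where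
  "s_dominant G i \<P> h b \<longleftrightarrow> (\<forall>a\<in>available G i h. a \<noteq> b \<longrightarrow> s_dominates G i h b a (\<P> h b a))"

end

(* Dominance gives s-dominance by exchanging quantifiers. Conversely, if s is s-dominant at every
   active information set that it reaches, then s is optimal against each single opponent strategy
   r: given a strategy s', look at the first stage where the plays of s and s' against r differ.
   S-dominance at the information set reached there, applied to the cell containing r, replaces s'
   by a strategy that is at least as good against r and, by perfect recall, follows the play of s
   for one stage longer. After at most T replacements the two plays coincide. Hence, whatever
   strategy witnesses s-dominance in a given cell, s itself does at least as well there, and so it
   is a witness for all cells simultaneously. *)

theory Submission
  imports Defs
begin

section \<open>Prefixes and experiences along a play\<close>

lemma fst_play [simp]: "fst (play G \<sigma> \<theta> t) = \<theta>"
  by (cases t) auto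

lemma length_snd_play [simp]: "length (snd (play G \<sigma> \<theta> t)) = t"
  by (induction t) auto

lemma take_snd_play: "k \<le> t \<Longrightarrow> take k (snd (play G \<sigma> \<theta> t)) = snd (play G \<sigma> \<theta> k)"
proof (induction t)
  case (Suc t)
  then show ?case
    by (cases "k = Suc t") (auto simp del: play.simps(2) simp: play.simps(2)[of G \<sigma> \<theta> t])
qed simp

lemma play_take: "k \<le> t \<Longrightarrow> (\<theta>, take k (snd (play G \<sigma> \<theta> t))) = play G \<sigma> \<theta> k"
  by (simp add: take_snd_play prod_eq_iff)

lemma nth_snd_play:
  assumes "k < t"
  shows "snd (play G \<sigma> \<theta> t) ! k = (\<lambda>j\<in>players G. the (\<sigma> j (infoset_of G j (play G \<sigma> \<theta> k))))"
proof -
  have "snd (play G \<sigma> \<theta> t) ! k = take (Suc k) (snd (play G \<sigma> \<theta> t)) ! k"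
    by simp
  also have "\<dots> = snd (play G \<sigma> \<theta> (Suc k)) ! k"
    using assms by (simp only: take_snd_play Suc_leI)
  finally show ?thesis
    by (simp add: nth_append)
qed

text \<open>Each prefix of a play is an earlier play of the same profile, so an experience can be
  read off the strategies. The actions appear as \<open>the\<close> values, genuine only where the
  strategy is defined.\<close>

lemma experience_play:
  assumes "j \<in> players G"
  shows "experience G j (play G \<sigma> \<theta> t) =
    map (\<lambda>k. (infoset_of G j (play G \<sigma> \<theta> k), the (\<sigma> j (infoset_of G j (play G \<sigma> \<theta> k))))) [0..<t]"
  using assms by (auto simp: experience_def play_take nth_snd_play)

text \<open>Turns \<open>reaches\<close> into the existence of a stage at which the play is in the
  information set.\<close>

lemma precedes_play_iff:
  "precedes x (play G \<sigma> \<theta> t) \<longleftrightarrow> (\<exists>k<t. x = play G \<sigma> \<theta> k)"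
proof
  assume pre: "precedes x (play G \<sigma> \<theta> t)"
  then have "length (snd x) < t"
    using prefix_length_less[of "snd x" "snd (play G \<sigma> \<theta> t)"] by (simp add: precedes_def)
  moreover have "x = play G \<sigma> \<theta> (length (snd x))"
  proof -
    have "snd x = take (length (snd x)) (snd (play G \<sigma> \<theta> t))"
      using pre by (auto simp: precedes_def strict_prefix_def prefix_def)
    then show ?thesis
      using pre calculation by (simp add: take_snd_play prod_eq_iff precedes_def)
  qed
  ultimately show "\<exists>k<t. x = play G \<sigma> \<theta> k"
    by blast
next
  assume "\<exists>k<t. x = play G \<sigma> \<theta> k"
  then obtain k where k: "k < t" "x = play G \<sigma> \<theta> k"
    by blast
  then have "snd x = take k (snd (play G \<sigma> \<theta> t))"
    by (simp add: take_snd_play)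
  then have "prefix (snd x) (snd (play G \<sigma> \<theta> t))"
    by (metis take_is_prefix)
  moreover have "snd x \<noteq> snd (play G \<sigma> \<theta> t)"
    using k by (metis length_snd_play less_irrefl)
  ultimately show "precedes x (play G \<sigma> \<theta> t)"
    using k by (simp add: precedes_def strict_prefix_def)
qed

section \<open>Uniqueness of information sets and finiteness of the game\<close>

context multistage_game
begin

lemma infoset_of_eq:
  assumes "j \<in> players G" "h \<in> infosets G j" "x \<in> h"
  shows "infoset_of G j x = h"
  unfolding infoset_of_def
proof (rule the_equality)
  show "h \<in> infosets G j \<and> x \<in> h"
    using assms by blast
  show "h' = h" if "h' \<in> infosets G j \<and> x \<in> h'" for h'
    using that assms partition_onD2[OF infosets_partition[OF assms(1)]]
    by (auto dest: disjointD)
qed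

lemma infoset_of_nonterminal:
  assumes "j \<in> players G" "x \<in> nonterminals G"
  shows "infoset_of G j x \<in> infosets G j" and "x \<in> infoset_of G j x"
proof -
  obtain h where "h \<in> infosets G j" "x \<in> h"
    using assms partition_onD1[OF infosets_partition[OF assms(1)]] by blast
  then show "infoset_of G j x \<in> infosets G j" and "x \<in> infoset_of G j x"
    using infoset_of_eq[OF assms(1)] by auto
qed

lemma finite_available:
  assumes "j \<in> players G" "h \<in> infosets G j"
  shows "finite (available G j h)"
  using assms available_subset finite_actions finite_subset by metis

lemma finite_feasible_profiles:
  assumes "x \<in> nonterminals G"
  shows "finite (feasible_profiles G x)"
  unfolding feasible_profiles_def
  using assms finite_players by (intro finite_PiE finite_available infoset_of_nonterminal) auto

text \<open>Each history has finitely many feasible profiles, so finiteness passes from stage to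
  stage. The index is \<open>Suc t\<close> because stages start at 1 and
  \<open>histories G 0\<close> is unconstrained.\<close>

lemma finite_histories: "t < horizon G \<Longrightarrow> finite (histories G (Suc t))"
proof (induction t)
  case 0
  have "histories G (Suc 0) = (\<lambda>\<theta>. (\<theta>, [])) ` states G"
    using histories_1 by auto
  then show ?case
    using finite_states by simp
next
  case (Suc t)
  let ?H = "histories G (Suc t)"
  have "successors G ?H =
      (\<lambda>(x, a). (fst x, snd x @ [a])) ` (SIGMA x:?H. feasible_profiles G x)"
    by (force simp: successors_def)
  moreover have "?H \<subseteq> nonterminals G"
    using Suc.prems by (force simp: nonterminals_def)
  then have "finite (SIGMA x:?H. feasible_profiles G x)"
    using Suc finite_feasible_profiles by (intro finite_SigmaI) auto
  ultimately show ?case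
    using Suc.prems histories_Suc[of "Suc t"] by simp
qed

lemma finite_nonterminals: "finite (nonterminals G)"
  unfolding nonterminals_def
proof (rule finite_UN_I)
  show "finite (histories G t)" if "t \<in> {1..horizon G}" for t
    using that finite_histories[of "t - 1"] by (cases t) auto
qed simp

lemma finite_strategies:
  assumes "j \<in> players G"
  shows "finite (strategies G j)"
proof -
  have fin: "finite (infosets G j)"
    using infosets_partition[OF assms] finite_nonterminals by (metis finite_elements)
  \<comment> \<open>The domain of a reduced strategy depends on its own actions, so the bound ranges
    over all candidate domains.\<close>
  have "strategies G j \<subseteq> (\<Union>D\<in>Pow (infosets G j). {s. dom s = D \<and> ran s \<subseteq> actions G j})"
  proof
    fix s
    assume s: "s \<in> strategies G j"
    have "ran s \<subseteq> actions G j"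
    proof
      fix a
      assume "a \<in> ran s"
      then obtain h where h: "s h = Some a"
        by (auto simp: ran_def)
      then have "h \<in> dom s"
        by blast
      then have "h \<in> infosets G j" and "the (s h) \<in> available G j h"
        using s by (auto simp: strategies_def)
      then show "a \<in> actions G j"
        using available_subset[OF assms] h by auto
    qed
    moreover have "dom s \<subseteq> infosets G j"
      using s by (auto simp: strategies_def)
    ultimately show "s \<in> (\<Union>D\<in>Pow (infosets G j). {s. dom s = D \<and> ran s \<subseteq> actions G j})"
      by blast
  qed
  moreover have "finite (\<Union>D\<in>Pow (infosets G j). {s. dom s = D \<and> ran s \<subseteq> actions G j})"
    using fin finite_actions[OF assms]
    by (intro finite_UN_I finite_set_of_finite_maps) (auto intro: finite_subset)
  ultimately show ?thesis
    by (rule finite_subset)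
qed

text \<open>Makes every cell finite, so that \<open>Min\<close> and \<open>Max\<close> over a
  nonempty cell are true extrema.\<close>

lemma finite_opp_strategies: "finite (opp_strategies G j)"
  unfolding opp_strategies_def
  using finite_states finite_players finite_strategies
  by (intro finite_cartesian_product finite_PiE) auto

section \<open>Strategy profiles generate legal plays\<close>

text \<open>The two claims need each other: the next profile is feasible because every strategy is
  defined at the current information set, and it is defined there because the play so far is legal
  and followed it. After \<open>t\<close> profiles the stage is \<open>t + 1\<close>, hence
  \<open>Suc t\<close>.\<close>

lemma play_history_and_consistent:
  assumes \<sigma>: "\<And>j. j \<in> players G \<Longrightarrow> \<sigma> j \<in> strategies G j"
    and \<theta>: "\<theta> \<in> states G"
  shows "t < horizon G \<Longrightarrow> play G \<sigma> \<theta> t \<in> histories G (Suc t) \<and>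
    (\<forall>k\<le>t. \<forall>j\<in>players G. infoset_of G j (play G \<sigma> \<theta> k) \<in> dom (\<sigma> j))"
proof -
  have dom: "infoset_of G j (play G \<sigma> \<theta> t) \<in> dom (\<sigma> j)"
    if "t < horizon G" "play G \<sigma> \<theta> t \<in> histories G (Suc t)" "j \<in> players G"
      "\<forall>k<t. \<forall>j\<in>players G. infoset_of G j (play G \<sigma> \<theta> k) \<in> dom (\<sigma> j)" for t j
  proof -
    have "play G \<sigma> \<theta> t \<in> nonterminals G"
      using that by (force simp: nonterminals_def)
    note info = infoset_of_nonterminal[OF \<open>j \<in> players G\<close> this]
    \<comment> \<open>Definedness at the earlier information sets turns the \<open>the\<close>
      values in the experience into genuine values of the strategy.\<close>
    have "\<forall>(h, a)\<in>set (experience G j (play G \<sigma> \<theta> t)). \<sigma> j h = Some a"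
      using that by (fastforce simp: experience_play)
    then have "consistent G j (\<sigma> j) (infoset_of G j (play G \<sigma> \<theta> t))"
      using info unfolding consistent_def by blast
    then show ?thesis
      using \<sigma>[OF that(3)] info by (simp add: strategies_def)
  qed
  show "t < horizon G \<Longrightarrow> play G \<sigma> \<theta> t \<in> histories G (Suc t) \<and>
    (\<forall>k\<le>t. \<forall>j\<in>players G. infoset_of G j (play G \<sigma> \<theta> k) \<in> dom (\<sigma> j))"
  proof (induction t)
    case 0
    then show ?case
      using \<theta> histories_1 dom[of 0] by simp
  next
    case (Suc t)
    let ?x = "play G \<sigma> \<theta> t"
    have IH: "?x \<in> histories G (Suc t)"
      "\<forall>k\<le>t. \<forall>j\<in>players G. infoset_of G j (play G \<sigma> \<theta> k) \<in> dom (\<sigma> j)"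
      using Suc by auto
    define a where "a = (\<lambda>j\<in>players G. the (\<sigma> j (infoset_of G j ?x)))"
    have "the (\<sigma> j (infoset_of G j ?x)) \<in> available G j (infoset_of G j ?x)"
      if "j \<in> players G" for j
      using IH \<sigma>[OF that] that unfolding strategies_def by blast
    then have "a \<in> feasible_profiles G ?x"
      by (simp add: a_def feasible_profiles_def restrict_PiE_iff)
    with IH have "(fst ?x, snd ?x @ [a]) \<in> successors G (histories G (Suc t))"
      unfolding successors_def by blast
    then have hist: "play G \<sigma> \<theta> (Suc t) \<in> histories G (Suc (Suc t))"
      using Suc.prems histories_Suc[of "Suc t"] by (simp add: a_def)
    have "infoset_of G j (play G \<sigma> \<theta> (Suc t)) \<in> dom (\<sigma> j)" if "j \<in> players G" for j
      using dom[OF Suc.prems hist that] IH by (simp add: less_Suc_eq_le del: play.simps)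
    with hist IH show ?case
      by (simp add: le_Suc_eq del: play.simps)
  qed
qed

lemma play_nonterminal:
  assumes "\<And>j. j \<in> players G \<Longrightarrow> \<sigma> j \<in> strategies G j" "\<theta> \<in> states G" "t < horizon G"
  shows "play G \<sigma> \<theta> t \<in> nonterminals G"
proof -
  have "play G \<sigma> \<theta> t \<in> histories G (Suc t)"
    using play_history_and_consistent[of \<sigma>] assms by blast
  moreover have "Suc t \<in> {1..horizon G}"
    using assms by simp
  ultimately show ?thesis
    unfolding nonterminals_def by blast
qed

lemma infoset_of_play_dom:
  assumes "\<And>j. j \<in> players G \<Longrightarrow> \<sigma> j \<in> strategies G j" "\<theta> \<in> states G" "t < horizon G"
    and "j \<in> players G"
  shows "infoset_of G j (play G \<sigma> \<theta> t) \<in> dom (\<sigma> j)"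
  using play_history_and_consistent[of \<sigma>] assms by blast

lemma strategies_available:
  assumes "s \<in> strategies G j" "h \<in> dom s"
  shows "the (s h) \<in> available G j h"
  using assms unfolding strategies_def by blast

lemma profile_strategies:
  assumes "s \<in> strategies G i" "r \<in> opp_strategies G i" "j \<in> players G"
  shows "((snd r)(i := s)) j \<in> strategies G j"
proof (cases "j = i")
  case False
  have "snd r \<in> (\<Pi>\<^sub>E j\<in>players G - {i}. strategies G j)"
    using assms(2) by (simp add: opp_strategies_def mem_Times_iff)
  then have "snd r j \<in> strategies G j"
    by (rule PiE_mem) (use False assms(3) in simp)
  with False show ?thesis
    by simp
qed (simp add: assms)

section \<open>Perfect recall and the comparison of plays\<close>

text \<open>A strategy that reaches \<open>h\<close> at some \<open>x\<close> has taken the actions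
  recorded at \<open>x\<close>, and perfect recall gives every \<open>y\<close> in \<open>h\<close>
  the same record.\<close>

lemma strategies_to_experience:
  assumes i: "i \<in> players G" and h: "h \<in> infosets G i" and y: "y \<in> h"
    and s: "s \<in> strategies_to G i h"
  shows "\<forall>(h', a)\<in>set (experience G i y). s h' = Some a"
proof -
  obtain r x where r: "r \<in> opp_strategies G i" and x: "x \<in> h" "precedes x (outcome G i s r)"
    and s': "s \<in> strategies G i"
    using s by (auto simp: strategies_to_def reaches_def)
  let ?\<sigma> = "(snd r)(i := s)"
  obtain k where k: "k < horizon G" "x = play G ?\<sigma> (fst r) k"
    using x by (auto simp: outcome_def precedes_play_iff)
  have "fst r \<in> states G"
    using r by (simp add: opp_strategies_def mem_Times_iff)
  then have "infoset_of G i (play G ?\<sigma> (fst r) m) \<in> dom s" if "m < k" for m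
    using infoset_of_play_dom[OF profile_strategies[OF s' r] _ _ i, of "fst r" m] that k(1)
    unfolding fun_upd_same by linarith
  then have "\<forall>(h', a)\<in>set (experience G i x). s h' = Some a"
    unfolding k by (auto simp: experience_play[OF i] domIff)
  then show ?thesis
    using perfect_recall[OF i h y x(1)] by simp
qed

lemma play_Suc_cong:
  assumes eq: "play G (\<rho>(i := s')) \<theta> t = play G (\<rho>(i := s)) \<theta> t"
    and "the (s' (infoset_of G i (play G (\<rho>(i := s)) \<theta> t))) =
      the (s (infoset_of G i (play G (\<rho>(i := s)) \<theta> t)))"
  shows "play G (\<rho>(i := s')) \<theta> (Suc t) = play G (\<rho>(i := s)) \<theta> (Suc t)"
proof -
  have "the ((\<rho>(i := s')) j (infoset_of G j (play G (\<rho>(i := s)) \<theta> t))) =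
      the ((\<rho>(i := s)) j (infoset_of G j (play G (\<rho>(i := s)) \<theta> t)))" for j
    using assms(2) by (cases "j = i") (simp_all only: fun_upd_same fun_upd_other not_False_eq_True)
  then show ?thesis
    unfolding play.simps eq by presburger
qed

text \<open>The experience records every earlier own action, so a strategy repeating them against
  the same opponents stays on the same path. With \<open>strategies_to_experience\<close>: if the
  play of \<open>s\<close> against given opponents reaches a history in \<open>h\<close>, every
  strategy that allows \<open>h\<close> reaches that history against them.\<close>

lemma play_cong_experience:
  assumes i: "i \<in> players G"
    and "\<forall>(h, a)\<in>set (experience G i (play G (\<rho>(i := s)) \<theta> t)). s' h = Some a"
  shows "play G (\<rho>(i := s')) \<theta> t = play G (\<rho>(i := s)) \<theta> t"
proof -
  have "play G (\<rho>(i := s')) \<theta> k = play G (\<rho>(i := s)) \<theta> k" if "k \<le> t" for k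
    using that
  proof (induction k)
    case (Suc k)
    \<comment> \<open>Here \<open>k < t\<close>, so this pair is an entry of the experience.\<close>
    then have "s' (infoset_of G i (play G (\<rho>(i := s)) \<theta> k)) =
        Some (the (s (infoset_of G i (play G (\<rho>(i := s)) \<theta> k))))"
      using assms by (auto simp: experience_play)
    then show ?case
      using Suc by (intro play_Suc_cong) (simp_all del: fun_upd_apply)
  qed simp
  then show ?thesis
    by simp
qed

section \<open>Optimality against each single opponent strategy\<close>

lemma s_dominant_pointwise_optimal:
  assumes i: "i \<in> players G"
    and part: "\<And>h b a. h \<in> active_infosets G i \<Longrightarrow> b \<in> available G i h \<Longrightarrow>
      a \<in> available G i h \<Longrightarrow> b \<noteq> a \<Longrightarrow> partition_on (opp_strategies_to G i h) (\<P> h b a)"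
    and s: "s \<in> strategies G i"
    and sdom: "\<forall>h\<in>active_infosets_under G i s. s_dominant G i \<P> h (the (s h))"
    and s': "s' \<in> strategies G i" and r: "r \<in> opp_strategies G i"
  shows "payoff G i (outcome G i s' r) \<le> payoff G i (outcome G i s r)"
proof -
  define T \<rho> \<theta> where "T = horizon G" and "\<rho> = snd r" and "\<theta> = fst r"
  have \<theta>: "\<theta> \<in> states G"
    using r by (simp add: \<theta>_def opp_strategies_def mem_Times_iff)
  \<comment> \<open>Induction on the number \<open>n\<close> of final stages at which the plays may
    differ; \<open>s'\<close> stays arbitrary because the step replaces it.\<close>
  have "payoff G i (outcome G i s' r) \<le> payoff G i (outcome G i s r)"
    if "n \<le> T" "s' \<in> strategies G i"
      "play G (\<rho>(i := s')) \<theta> (T - n) = play G (\<rho>(i := s)) \<theta> (T - n)" for n s'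
    using that
  proof (induction n arbitrary: s')
    case 0
    then show ?case
      by (simp add: outcome_def T_def \<rho>_def \<theta>_def del: fun_upd_apply)
  next
    case (Suc n)
    define t where "t = T - Suc n"
    have t: "t < T" "T - n = Suc t"
      using Suc.prems(1) by (auto simp: t_def)
    define x h where "x = play G (\<rho>(i := s)) \<theta> t" and "h = infoset_of G i x"
    have x': "x = play G (\<rho>(i := s')) \<theta> t"
      unfolding x_def t_def by (rule Suc.prems(3)[symmetric])
    have "x \<in> nonterminals G"
      using play_nonterminal[OF profile_strategies[OF s r] \<theta>] t(1)
      unfolding x_def T_def \<rho>_def by blast
    then have h: "h \<in> infosets G i" "x \<in> h"
      using infoset_of_nonterminal[OF i] by (auto simp: h_def)
    have reach: "reaches G i s r h" "reaches G i s' r h"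
      unfolding reaches_def outcome_def precedes_play_iff
      using h t x' by (auto simp: x_def T_def \<rho>_def \<theta>_def)
    \<comment> \<open>The history \<open>x\<close> lies on both plays, so both strategies are
      defined at \<open>h\<close>.\<close>
    have h_dom: "h \<in> dom s" "h \<in> dom s'"
      using infoset_of_play_dom[OF profile_strategies[OF s r] \<theta> _ i, of t]
        infoset_of_play_dom[OF profile_strategies[OF Suc.prems(2) r] \<theta> _ i, of t] t(1)
      unfolding h_def x_def T_def \<rho>_def fun_upd_same x'[unfolded x_def \<rho>_def, symmetric]
      by blast+
    show ?case
    proof (cases "s' h = s h")
      case True
      then show ?thesis
        using play_Suc_cong[of \<rho> i s' \<theta> t s] Suc.IH[OF _ Suc.prems(2)] Suc.prems t
        by (simp add: h_def x_def del: play.simps fun_upd_apply flip: t_def)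
    next
      case False
      obtain b a where ba: "s h = Some b" "s' h = Some a"
        using h_dom by blast
      with False have "b \<noteq> a"
        by simp
      have avail: "b \<in> available G i h" "a \<in> available G i h"
        using strategies_available[OF s h_dom(1)] strategies_available[OF Suc.prems(2) h_dom(2)] ba
        by simp_all
      \<comment> \<open>Two distinct available actions make \<open>h\<close> active; finiteness
        matters because \<open>card\<close> of an infinite set is 0.\<close>
      have "card {a, b} \<le> card (available G i h)"
        using avail finite_available[OF i h(1)] by (intro card_mono) auto
      then have active: "h \<in> active_infosets G i"
        using \<open>b \<noteq> a\<close> h by (simp add: active_infosets_def)
      have "s \<in> strategies_to G i h"
        using s r reach by (auto simp: strategies_to_def)
      then have "s_dominates G i h b a (\<P> h b a)"
        using sdom active avail \<open>b \<noteq> a\<close> ba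
        by (force simp: active_infosets_under_def s_dominant_def)
      moreover have "s' \<in> strategies_playing G i h a"
        using Suc.prems(2) r reach ba by (auto simp: strategies_playing_def strategies_to_def)
      moreover have "r \<in> opp_strategies_to G i h"
        using r s reach by (auto simp: opp_strategies_to_def)
      \<comment> \<open>The cells cover all opponent strategies that allow \<open>h\<close>, and
        \<open>s\<close> reaches \<open>h\<close> against \<open>r\<close>.\<close>
      then obtain C where C: "C \<in> \<P> h b a" "r \<in> C"
        using partition_onD1[OF part[OF active avail \<open>b \<noteq> a\<close>]] by blast
      ultimately obtain s'' where s'': "s'' \<in> strategies_playing G i h b"
        and le: "Max ((\<lambda>r. payoff G i (outcome G i s' r)) ` C)
          \<le> Min ((\<lambda>r. payoff G i (outcome G i s'' r)) ` C)"
        unfolding s_dominates_def by blast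
      have "C \<subseteq> opp_strategies G i"
        using C partition_onD1[OF part[OF active avail \<open>b \<noteq> a\<close>]]
        by (auto simp: opp_strategies_to_def)
      then have "finite C"
        using finite_opp_strategies finite_subset by blast
      then have "payoff G i (outcome G i s' r) \<le> Max ((\<lambda>r. payoff G i (outcome G i s' r)) ` C)"
        using C by (intro Max_ge) auto
      also note le
      also have "Min ((\<lambda>r. payoff G i (outcome G i s'' r)) ` C) \<le> payoff G i (outcome G i s'' r)"
        using C \<open>finite C\<close> by (intro Min_le) auto
      also have "\<dots> \<le> payoff G i (outcome G i s r)"
      proof (rule Suc.IH)
        show "s'' \<in> strategies G i"
          using s'' by (simp add: strategies_playing_def strategies_to_def)
        \<comment> \<open>The strategy \<open>s''\<close> is only known to reach \<open>h\<close>
          against some opponents, perhaps not \<open>r\<close>. Perfect recall brings it to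
          \<open>x\<close> against \<open>r\<close> as well, and there it plays \<open>b\<close> as
          \<open>s\<close> does, so the agreement grows by one stage.\<close>
        have "\<forall>(h', a)\<in>set (experience G i x). s'' h' = Some a"
          using strategies_to_experience[OF i h] s'' by (simp add: strategies_playing_def)
        then have "play G (\<rho>(i := s'')) \<theta> t = play G (\<rho>(i := s)) \<theta> t"
          unfolding x_def by (rule play_cong_experience[OF i])
        moreover have "the (s'' h) = the (s h)"
          using s'' ba by (simp add: strategies_playing_def)
        ultimately show "play G (\<rho>(i := s'')) \<theta> (T - n) = play G (\<rho>(i := s)) \<theta> (T - n)"
          unfolding t(2) h_def x_def by (rule play_Suc_cong)
      qed (use Suc.prems in simp)
      finally show ?thesis .
    qed
  qed
  \<comment> \<open>For \<open>n = T\<close> the agreement concerns the empty list of profiles and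
    is trivial.\<close>
  from this[of T s'] s' show ?thesis
    by simp
qed

section \<open>From optimality to the equivalence\<close>

text \<open>Reaching \<open>h\<close> makes \<open>s\<close> consistent with it, and the domain
  consists of the consistent information sets. Hence \<open>the (s h)\<close> is a genuine action at
  every information set that \<open>s\<close> reaches.\<close>

lemma strategies_to_dom:
  assumes i: "i \<in> players G" and h: "h \<in> infosets G i" and s: "s \<in> strategies_to G i h"
  shows "h \<in> dom s"
proof -
  obtain x where "x \<in> h"
    using s by (auto simp: strategies_to_def reaches_def)
  then have "consistent G i s h"
    using strategies_to_experience[OF i h _ s] unfolding consistent_def by blast
  then show ?thesis
    using s h by (simp add: strategies_to_def strategies_def)
qed

lemma s_dominant_imp_dominant:
  assumes i: "i \<in> players G"
    and part: "\<And>h b a. h \<in> active_infosets G i \<Longrightarrow> b \<in> available G i h \<Longrightarrow>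
      a \<in> available G i h \<Longrightarrow> b \<noteq> a \<Longrightarrow> partition_on (opp_strategies_to G i h) (\<P> h b a)"
    and s: "s \<in> strategies G i"
    and sdom: "\<forall>h\<in>active_infosets_under G i s. s_dominant G i \<P> h (the (s h))"
    and h: "h \<in> active_infosets_under G i s"
  shows "dominant G i \<P> h (the (s h))"
  unfolding dominant_def dominates_def
proof (intro ballI impI)
  fix a s\<^sub>0
  assume a: "a \<in> available G i h" "a \<noteq> the (s h)" and s0: "s\<^sub>0 \<in> strategies_playing G i h a"
  define b where "b = the (s h)"
  have active: "h \<in> active_infosets G i" and to: "s \<in> strategies_to G i h"
    using h by (auto simp: active_infosets_under_def)
  have h_dom: "h \<in> dom s"
    using strategies_to_dom[OF i _ to] active by (simp add: active_infosets_def)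
  then have "b \<in> available G i h"
    using s by (simp add: strategies_def b_def)
  with a have P: "partition_on (opp_strategies_to G i h) (\<P> h b a)"
    using part[OF active] by (auto simp: b_def)
  have "Max ((\<lambda>r. payoff G i (outcome G i s\<^sub>0 r)) ` C)
      \<le> Min ((\<lambda>r. payoff G i (outcome G i s r)) ` C)" if C: "C \<in> \<P> h b a" for C
  proof -
    have opp: "C \<subseteq> opp_strategies G i"
      using C partition_onD1[OF P] by (auto simp: opp_strategies_to_def)
    then have fin: "finite C"
      using finite_opp_strategies finite_subset by blast
    have ne: "C \<noteq> {}"
      using C partition_onD3[OF P] by blast
    obtain s' where s': "s' \<in> strategies_playing G i h b"
      and le: "Max ((\<lambda>r. payoff G i (outcome G i s\<^sub>0 r)) ` C)
        \<le> Min ((\<lambda>r. payoff G i (outcome G i s' r)) ` C)"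
      using sdom h a s0 C unfolding s_dominant_def s_dominates_def b_def by blast
    have "s' \<in> strategies G i"
      using s' by (simp add: strategies_playing_def strategies_to_def)
    \<comment> \<open>The witness \<open>s'\<close> may vary with the cell; optimality of
      \<open>s\<close> against each \<open>r\<close> removes this dependence.\<close>
    then have "payoff G i (outcome G i s' r) \<le> payoff G i (outcome G i s r)" if "r \<in> C" for r
      using that opp by (intro s_dominant_pointwise_optimal[OF i part s sdom]) auto
    \<comment> \<open>The pointwise inequality passes to the minima because the cell is finite and
      nonempty.\<close>
    then have "Min ((\<lambda>r. payoff G i (outcome G i s' r)) ` C)
        \<le> Min ((\<lambda>r. payoff G i (outcome G i s r)) ` C)"
      using fin ne by (auto simp: Min_le_iff intro!: Min.boundedI)
    with le show ?thesis
      by linarith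
  qed
  moreover have "s \<in> strategies_playing G i h b"
    using to h_dom by (auto simp: strategies_playing_def b_def)
  ultimately show "\<exists>s'\<in>strategies_playing G i h (the (s h)). \<forall>C\<in>\<P> h (the (s h)) a.
      Max ((\<lambda>r. payoff G i (outcome G i s\<^sub>0 r)) ` C)
        \<le> Min ((\<lambda>r. payoff G i (outcome G i s' r)) ` C)"
    unfolding b_def by blast
qed

end

text \<open>This direction works at each information set separately, whereas the converse uses
  s-dominance at all active information sets that the strategy reaches.\<close>

lemma dominant_imp_s_dominant: "dominant G i \<P> h b \<Longrightarrow> s_dominant G i \<P> h b"
  unfolding dominant_def s_dominant_def dominates_def s_dominates_def by blast

theorem theorem2:
  fixes G :: "('i, 's, 'a) game"
    and i :: 'i
    and \<P> :: "('i, 's, 'a) infoset \<Rightarrow> 'a \<Rightarrow> 'a \<Rightarrow> ('i, 's, 'a) opp_strategy set set"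
    and s :: "('i, 's, 'a) strategy"
  assumes "multistage_game G"
    and "i \<in> players G"
    and "\<And>h b a. h \<in> active_infosets G i \<Longrightarrow> b \<in> available G i h \<Longrightarrow> a \<in> available G i h \<Longrightarrow>
      b \<noteq> a \<Longrightarrow> partition_on (opp_strategies_to G i h) (\<P> h b a)"
    and "s \<in> strategies G i"
  shows "(\<forall>h\<in>active_infosets_under G i s. dominant G i \<P> h (the (s h))) \<longleftrightarrow>
         (\<forall>h\<in>active_infosets_under G i s. s_dominant G i \<P> h (the (s h)))"
proof
  assume "\<forall>h\<in>active_infosets_under G i s. s_dominant G i \<P> h (the (s h))"
  then have "dominant G i \<P> h (the (s h))" if "h \<in> active_infosets_under G i s" for h
    using multistage_game.s_dominant_imp_dominant[OF assms(1,2) _ assms(4) _ that] assms(3) by blast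
  then show "\<forall>h\<in>active_infosets_under G i s. dominant G i \<P> h (the (s h))"
    by blast
qed (blast intro: dominant_imp_s_dominant)

end
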